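(* Let $A\in\mathbb{R}^{m\times n}$ and let $h:\mathbb{R}^m\to\mathbb{R}_+$ be a continuous convex function. (i) Suppose that $H$ is single-valued and Lipschitz continuous on a convex open set $U\subset\mathbb{R}^m\times\mathbb{R}_{++}$, and that $h$ is continuously differentiable at $Ax-b$ for all $(b,\lambda)\in U$ and $x$ with $Ax\in H(b,\lambda)$. Then $S$ is (Hausdorff) Lipschitz continuous relative to $U$. (ii) Let $(\bar b,\bar\lambda)\in\mathbb{R}^m\times\mathbb{R}_{++}$, and suppose that there is $\bar x\in S(\bar b,\bar\lambda)$ such that $h$ is twice continuously differentiable around $A\bar x-\bar b$ and $$\ker(\nabla^2h(A\bar x-\bar b))\cap \mathrm{rge}(A_{J_h})=\{0\},\qquad J_h:=\{i\in[n]: |A_i^T\nabla h(A\bar x-\bar b)|=\bar\lambda\}.$$ Then $S$ is locally (Hausdorff) Lipschitz continuous at $(\bar b,\bar\lambda)$.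
   Context: $\mathbb{R}_+=[0,\infty)$, $\mathbb{R}_{++}=(0,\infty)$, $[n]=\{1,\dots,n\}$; $\|\cdot\|$ is the Euclidean norm and $\|\cdot\|_1$ the $\ell_1$-norm. For $(b,\lambda)\in\mathbb{R}^m\times\mathbb{R}_+$, $S(b,\lambda):=\mathrm{argmin}_{x\in\mathbb{R}^n}\{h(Ax-b)+\lambda\|x\|_1\}$ (a set-valued mapping), and for $\lambda>0$, $H(b,\lambda):=\{Ax:x\in S(b,\lambda)\}$. $A_i$ is the $i$-th column of $A$; for $I\subset[n]$, $A_I$ is the submatrix of columns of $A$ indexed by $I$, and $\mathrm{rge}(A_I)$ is its range ($\{0\}$ if $I=\emptyset$). A set-valued mapping $F$ is (Hausdorff) Lipschitz continuous relative to $D$ if there is $\kappa\in(0,\infty)$ with $d_H(F(z),F(z'))\le\kappa\|z-z'\|$ for all $z,z'\in D$, where $d_H(C,D)=\max\{e(C,D),e(D,C)\}$ and $e(C,D)=\sup_{x\in C}d(x,D)$. $F$ is locally (Hausdorff) Lipschitz at (around) $\bar z$ if it is Lipschitz continuous relative to some open ball $B(\bar z,\delta)$, $\delta>0$. Single-valued means that the value is a singleton. *)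

theory Defs
  imports "HOL-Analysis.Analysis"
begin

definition l1_norm :: "real ^ 'n \<Rightarrow> real" where
  "l1_norm x = (\<Sum>i\<in>UNIV. \<bar>x $ i\<bar>)"

(* The parameter is z = (b, lambda).  The maps are total here, but only the values at
   lambda >= 0 (sol_map) and lambda > 0 (fit_map) are meaningful. *)

definition sol_map ::
    "real ^ 'n ^ 'm \<Rightarrow> (real ^ 'm \<Rightarrow> real) \<Rightarrow> (real ^ 'm) \<times> real \<Rightarrow> (real ^ 'n) set" where
  "sol_map A h z =
     {x. is_arg_min (\<lambda>x. h (A *v x - fst z) + snd z * l1_norm x) (\<lambda>_. True) x}"

definition fit_map ::
    "real ^ 'n ^ 'm \<Rightarrow> (real ^ 'm \<Rightarrow> real) \<Rightarrow> (real ^ 'm) \<times> real \<Rightarrow> (real ^ 'm) set" where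
  "fit_map A h z = {A *v x |x. x \<in> sol_map A h z}"

(* Distances are taken in ennreal: an infimum over the empty set is then infinity, a supremum
   over the empty set is 0, and unbounded suprema keep their meaning (unlike infdist and real
   suprema). *)

definition point_dist :: "'a::metric_space \<Rightarrow> 'a set \<Rightarrow> ennreal" where
  "point_dist x D = (INF y\<in>D. ennreal (dist x y))"

definition excess :: "'a::metric_space set \<Rightarrow> 'a set \<Rightarrow> ennreal" where
  "excess C D = (SUP x\<in>C. point_dist x D)"

definition hausdorff_dist :: "'a::metric_space set \<Rightarrow> 'a set \<Rightarrow> ennreal" where
  "hausdorff_dist C D = max (excess C D) (excess D C)"

definition hausdorff_lipschitz_on ::
    "'a::metric_space set \<Rightarrow> ('a \<Rightarrow> 'b::metric_space set) \<Rightarrow> bool" where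
  "hausdorff_lipschitz_on D F \<longleftrightarrow>
     (\<exists>\<kappa>>0. \<forall>z\<in>D. \<forall>z'\<in>D. hausdorff_dist (F z) (F z') \<le> ennreal (\<kappa> * dist z z'))"

definition locally_hausdorff_lipschitz_at ::
    "('a::metric_space \<Rightarrow> 'b::metric_space set) \<Rightarrow> 'a \<Rightarrow> bool" where
  "locally_hausdorff_lipschitz_at F z \<longleftrightarrow> (\<exists>\<delta>>0. hausdorff_lipschitz_on (ball z \<delta>) F)"

definition single_valued_map_on :: "'a set \<Rightarrow> ('a \<Rightarrow> 'b set) \<Rightarrow> bool" where
  "single_valued_map_on D F \<longleftrightarrow> (\<forall>z\<in>D. is_singleton (F z))"

(* Both grad and hessian are junk values where the derivative in question does not exist. *)

definition grad :: "('a::real_inner \<Rightarrow> real) \<Rightarrow> 'a \<Rightarrow> 'a" where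
  "grad h z = (THE g. GDERIV h z :> g)"

definition hessian :: "(real ^ 'm \<Rightarrow> real) \<Rightarrow> real ^ 'm \<Rightarrow> real ^ 'm ^ 'm" where
  "hessian h z = jacobian (grad h) (at z)"

(* For convex h, differentiability on the neighbourhood V already makes the gradient continuous
   on all of V, so requiring continuity only at z is no restriction of the notion. *)
definition cont_diff_at :: "('a::real_inner \<Rightarrow> real) \<Rightarrow> 'a \<Rightarrow> bool" where
  "cont_diff_at h z \<longleftrightarrow>
     (\<exists>V. open V \<and> z \<in> V \<and> (\<forall>y\<in>V. h differentiable (at y)) \<and> isCont (grad h) z)"

definition twice_cont_diff_around :: "(real ^ 'm \<Rightarrow> real) \<Rightarrow> real ^ 'm \<Rightarrow> bool" where
  "twice_cont_diff_around h z \<longleftrightarrow>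
     (\<exists>V. open V \<and> z \<in> V \<and>
        (\<forall>y\<in>V. h differentiable (at y)) \<and>
        (\<forall>y\<in>V. grad h differentiable (at y)) \<and>
        continuous_on V (hessian h))"

definition mat_ker :: "real ^ 'n ^ 'm \<Rightarrow> (real ^ 'n) set" where
  "mat_ker M = {v. M *v v = 0}"

(* The range of the submatrix of A with columns indexed by I: all A_I c with c in R^I,
   where c is given as a function on all of 'n that is only evaluated on I. *)
definition rge_cols :: "real ^ 'n ^ 'm \<Rightarrow> 'n set \<Rightarrow> (real ^ 'm) set" where
  "rge_cols A I = range (\<lambda>c :: 'n \<Rightarrow> real. \<Sum>i\<in>I. c i *\<^sub>R column i A)"

definition equi_index ::
    "real ^ 'n ^ 'm \<Rightarrow> (real ^ 'm \<Rightarrow> real) \<Rightarrow> (real ^ 'm) \<times> real \<Rightarrow> real ^ 'n \<Rightarrow> 'n set" where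
  "equi_index A h z x = {i. \<bar>column i A \<bullet> grad h (A *v x - fst z)\<bar> = snd z}"

end

theory Submission
  imports Defs
begin

text \<open>
  Both parts rest on one observation.  If all solutions for the parameter \<open>z = (b, \<lambda>)\<close> have the
  same fit \<open>y\<close>, they have the same loss, so they are exactly the minimizers of the l1 norm
  subject to \<open>A *v x = y\<close>.  These minimizers form the solution set of a linear program with
  right-hand side \<open>y\<close>, and such a set is Hausdorff Lipschitz in \<open>y\<close>: the optimal value is Lipschitz
  in \<open>y\<close>, and Hoffman's error bound (\<open>hoffman_error_bound\<close>) controls the distance to a polyhedron
  by the constraint violation.  This is \<open>l1_minimizers_lipschitz\<close>.  Consequently the solution map is
  Lipschitz wherever the fit is unique and Lipschitz (\<open>sol_map_lipschitz\<close>), and the first part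
  follows.

  For the second part it remains to show that near the reference parameter solutions exist, and
  that their fit is unique and Lipschitz.  Existence is coercivity of the penalty.  For the rest, let
  \<open>J\<close> be the index set of the theorem.  By first-order optimality and continuity of the gradient, all
  solutions near the reference one vanish outside \<open>J\<close>, so differences of fits lie in the range of
  the columns in \<open>J\<close>.  There the Hessian of \<open>h\<close> is positive definite: by convexity its quadratic form
  can vanish only on its kernel (\<open>isotropic_in_kernel_if_cyclically_monotone\<close>), which meets the
  range only in \<open>0\<close>.  Strong monotonicity of the gradient, played against monotonicity of the
  subdifferential of the l1 norm, then bounds the difference of two fits by the difference of the
  parameters (\<open>local_fit_estimate\<close>).  That estimate concerns solutions with fits close to the
  reference fit; a convexity argument makes the fit unique at the reference parameter, and
  compactness then forces all solutions for nearby parameters into its range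
  (\<open>fit_near_unique_fit\<close>).
\<close>

section \<open>Hoffman's error bound\<close>

text \<open>
  The compactness core of the error bound below.  The right-hand side vanishes only if \<open>v\<close>
  lies in the cone \<open>{d. L d = 0 \<and> (\<forall>i\<in>J. a i \<bullet> d \<le> 0)}\<close>; a vector of the polar of that cone
  which also lies in the cone itself satisfies \<open>v \<bullet> v \<le> 0\<close>.  So the right-hand side is positive on
  the unit vectors of the polar, which form a compact set, and both sides are positively
  homogeneous.
\<close>

lemma norm_bounded_below_on_polar:
  fixes L :: "'a::euclidean_space \<Rightarrow> 'b::real_normed_vector" and a :: "'i \<Rightarrow> 'a"
  assumes L: "bounded_linear L" and J: "finite J"
  shows "\<exists>c>0. \<forall>v. (\<forall>d. L d = 0 \<and> (\<forall>i\<in>J. a i \<bullet> d \<le> 0) \<longrightarrow> v \<bullet> d \<le> 0) \<longrightarrow>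
           c * norm v \<le> norm (L v) + (\<Sum>i\<in>J. max 0 (a i \<bullet> v))"
proof -
  define D where "D = {d. L d = 0 \<and> (\<forall>i\<in>J. a i \<bullet> d \<le> 0)}"
  define P where "P = (\<Inter>d\<in>D. {v. v \<bullet> d \<le> 0})"
  define f where "f v = norm (L v) + (\<Sum>i\<in>J. max 0 (a i \<bullet> v))" for v
  interpret L: bounded_linear L by (fact L)
  have closed_P: "closed P"
    unfolding P_def by (intro closed_INT ballI closed_Collect_le continuous_intros)
  have cont: "continuous_on S f" for S
    unfolding f_def by (intro continuous_intros L.continuous_on)
  have f_nonneg: "0 \<le> f v" for v
    unfolding f_def by (intro add_nonneg_nonneg sum_nonneg) auto
  have f_pos: "0 < f v" if v: "v \<in> P" "norm v = 1" for v
  proof (rule ccontr)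
    assume "\<not> 0 < f v"
    then have "f v = 0" using f_nonneg[of v] by simp
    moreover have s: "0 \<le> (\<Sum>i\<in>J. max 0 (a i \<bullet> v))" by (intro sum_nonneg) auto
    ultimately have "L v = 0" and "(\<Sum>i\<in>J. max 0 (a i \<bullet> v)) = 0"
      unfolding f_def using norm_ge_zero[of "L v"] by (simp_all add: add_nonneg_eq_0_iff)
    then have "\<forall>i\<in>J. max 0 (a i \<bullet> v) = 0" using J by (subst (asm) sum_nonneg_eq_0_iff) auto
    then have "v \<in> D" unfolding D_def using \<open>L v = 0\<close> by (auto simp: max_def split: if_splits)
    then have "v \<bullet> v \<le> 0" using v unfolding P_def by auto
    then show False using v by (simp add: dot_square_norm)
  qed
  have "\<exists>c>0. \<forall>v\<in>P \<inter> sphere 0 1. c \<le> f v"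
  proof (cases "P \<inter> sphere 0 1 = {}")
    case True
    then show ?thesis by (intro exI[of _ 1]) auto
  next
    case False
    have "compact (P \<inter> sphere 0 1)" using closed_P by (simp add: closed_Int_compact)
    from continuous_attains_inf[OF this False cont]
    obtain v0 where "v0 \<in> P \<inter> sphere 0 1" "\<forall>v\<in>P \<inter> sphere 0 1. f v0 \<le> f v" by blast
    then show ?thesis using f_pos[of v0] by (intro exI[of _ "f v0"]) auto
  qed
  then obtain c where c: "c > 0" "\<And>v. v \<in> P \<Longrightarrow> norm v = 1 \<Longrightarrow> c \<le> f v" by auto
  have f_scale: "f (t *\<^sub>R v) = t * f v" if "t > 0" for t v
  proof -
    have "max 0 (t * (a i \<bullet> v)) = t * max 0 (a i \<bullet> v)" for i
      using that by (simp add: max_def mult_le_0_iff zero_le_mult_iff)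
    then show ?thesis unfolding f_def using that by (simp add: L.scaleR sum_distrib_left algebra_simps)
  qed
  have "c * norm v \<le> f v" if "v \<in> P" for v
  proof (cases "v = 0")
    case True
    then show ?thesis using f_nonneg by simp
  next
    case False
    define u where "u = (1 / norm v) *\<^sub>R v"
    have "u \<in> P" using that False unfolding P_def u_def by (auto simp: divide_le_0_iff)
    moreover have "norm u = 1" using False by (simp add: u_def)
    ultimately have "c \<le> f u" by (rule c)
    moreover have "f u = (1 / norm v) * f v" unfolding u_def using False by (intro f_scale) simp
    ultimately show ?thesis using False by (simp add: field_simps)
  qed
  then show ?thesis using c(1) unfolding P_def D_def f_def by (intro exI[of _ c]) blast
qed

text \<open>
  Hoffman's theorem: the distance of \<open>x\<close> to a nonempty polyhedron is bounded by its constraint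
  violation, with a constant that does not depend on the right-hand sides \<open>y\<close> and \<open>\<beta>\<close>.  If \<open>p\<close> is
  the projection of \<open>x\<close> and \<open>J\<close> the set of constraints active at \<open>p\<close>, then every direction of the
  cone given by \<open>L\<close> and \<open>J\<close> is feasible at \<open>p\<close>, so \<open>x - p\<close> is in the polar of that cone and the
  preceding lemma applies.  Only finitely many active sets occur, hence one constant serves them
  all.
\<close>

theorem hoffman_error_bound:
  fixes L :: "'a::euclidean_space \<Rightarrow> 'b::real_normed_vector" and a :: "'i \<Rightarrow> 'a"
  assumes L: "bounded_linear L" and I: "finite I"
  obtains \<kappa> where "\<kappa> > 0"
    and "\<And>y \<beta> x q. \<lbrakk>L q = y; \<forall>i\<in>I. a i \<bullet> q \<le> \<beta> i\<rbrakk> \<Longrightarrow>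
      \<exists>p. L p = y \<and> (\<forall>i\<in>I. a i \<bullet> p \<le> \<beta> i) \<and>
          dist x p \<le> \<kappa> * (norm (L x - y) + (\<Sum>i\<in>I. max 0 (a i \<bullet> x - \<beta> i)))"
proof -
  interpret L: bounded_linear L by (fact L)
  define polar where
    "polar J = {v. \<forall>d. L d = 0 \<and> (\<forall>i\<in>J. a i \<bullet> d \<le> 0) \<longrightarrow> v \<bullet> d \<le> 0}" for J
  have "\<forall>J\<in>Pow I. \<exists>c>0. \<forall>v\<in>polar J. c * norm v \<le> norm (L v) + (\<Sum>i\<in>J. max 0 (a i \<bullet> v))"
  proof
    fix J assume "J \<in> Pow I"
    then have "finite J" using I finite_subset by auto
    from norm_bounded_below_on_polar[OF L this, of a]
    show "\<exists>c>0. \<forall>v\<in>polar J. c * norm v \<le> norm (L v) + (\<Sum>i\<in>J. max 0 (a i \<bullet> v))"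
      unfolding polar_def by simp
  qed
  then obtain c where c: "\<And>J. J \<subseteq> I \<Longrightarrow> c J > 0"
      "\<And>J v. J \<subseteq> I \<Longrightarrow> v \<in> polar J \<Longrightarrow> c J * norm v \<le> norm (L v) + (\<Sum>i\<in>J. max 0 (a i \<bullet> v))"
    by (metis PowI)
  define \<kappa> where "\<kappa> = (\<Sum>J\<in>Pow I. 1 / c J)"
  have c_le: "1 / c J \<le> \<kappa>" if "J \<subseteq> I" for J
    unfolding \<kappa>_def using that I c(1) by (intro member_le_sum) (auto simp: less_imp_le)
  have \<kappa>: "\<kappa> > 0" using c_le[of "{}"] c(1)[of "{}"] by (meson less_le_trans empty_subsetI zero_less_divide_1_iff)
  moreover have "\<exists>p. L p = y \<and> (\<forall>i\<in>I. a i \<bullet> p \<le> \<beta> i) \<and>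
          dist x p \<le> \<kappa> * (norm (L x - y) + (\<Sum>i\<in>I. max 0 (a i \<bullet> x - \<beta> i)))"
    if q: "L q = y" "\<forall>i\<in>I. a i \<bullet> q \<le> \<beta> i" for y \<beta> x q
  proof -
    define P where "P = {p. L p = y} \<inter> (\<Inter>i\<in>I. {p. a i \<bullet> p \<le> \<beta> i})"
    have "closed P"
      unfolding P_def
      by (intro closed_Int closed_INT ballI closed_Collect_le closed_Collect_eq continuous_intros
          L.continuous_on)
    have "convex P"
      unfolding P_def
    proof (intro convex_Int convex_INT)
      show "convex {p. L p = y}"
        by (auto simp: convex_def L.add L.scaleR simp flip: scaleR_add_left)
      show "convex {p. a i \<bullet> p \<le> \<beta> i}" for i by (rule convex_halfspace_le)
    qed
    have "q \<in> P" using q unfolding P_def by simp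
    define p where "p = closest_point P x"
    have p: "p \<in> P"
      unfolding p_def using \<open>closed P\<close> \<open>q \<in> P\<close> by (intro closest_point_in_set) auto
    have proj: "(x - p) \<bullet> (u - p) \<le> 0" if "u \<in> P" for u
      unfolding p_def using \<open>convex P\<close> \<open>closed P\<close> that by (rule closest_point_dot)
    define J where "J = {i\<in>I. a i \<bullet> p = \<beta> i}"
    \<comment> \<open>A feasible direction \<open>d\<close> keeps \<open>p + t *\<^sub>R d\<close> in \<open>P\<close> for small \<open>t\<close>, and \<open>p\<close> is a projection.\<close>
    have "x - p \<in> polar J"
      unfolding polar_def
    proof (intro CollectI allI impI)
      fix d assume d: "L d = 0 \<and> (\<forall>i\<in>J. a i \<bullet> d \<le> 0)"
      have "eventually (\<lambda>t. \<forall>i\<in>I. a i \<bullet> (p + t *\<^sub>R d) \<le> \<beta> i) (at_right 0)"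
        using I
      proof (rule eventually_ball_finite, intro ballI)
        fix i assume i: "i \<in> I"
        show "eventually (\<lambda>t. a i \<bullet> (p + t *\<^sub>R d) \<le> \<beta> i) (at_right 0)"
        proof (cases "i \<in> J")
          case True
          then show ?thesis
            using d by (intro eventually_at_rightI[of 0 1])
              (auto simp: J_def inner_add_right mult_nonneg_nonpos)
        next
          case False
          then have "a i \<bullet> p < \<beta> i" using i p unfolding J_def P_def by fastforce
          moreover have "((\<lambda>t. a i \<bullet> (p + t *\<^sub>R d)) \<longlongrightarrow> a i \<bullet> (p + 0 *\<^sub>R d)) (at_right 0)"
            by (intro tendsto_intros)
          ultimately have "eventually (\<lambda>t. a i \<bullet> (p + t *\<^sub>R d) < \<beta> i) (at_right 0)"
            using order_tendstoD(2) by fastforce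
          then show ?thesis by eventually_elim simp
        qed
      qed
      then have "eventually (\<lambda>t. (\<forall>i\<in>I. a i \<bullet> (p + t *\<^sub>R d) \<le> \<beta> i) \<and> t > 0) (at_right 0)"
        by (intro eventually_conj eventually_at_right_less)
      then obtain t where t: "t > 0" "\<forall>i\<in>I. a i \<bullet> (p + t *\<^sub>R d) \<le> \<beta> i"
        using eventually_happens by force
      then have "p + t *\<^sub>R d \<in> P" using p d unfolding P_def by (simp add: L.add L.scaleR)
      from proj[OF this] t show "(x - p) \<bullet> d \<le> 0" by (simp add: mult_le_0_iff)
    qed
    then have "c J * norm (x - p) \<le> norm (L (x - p)) + (\<Sum>i\<in>J. max 0 (a i \<bullet> (x - p)))"
      by (intro c(2)) (auto simp: J_def)
    also have "(\<Sum>i\<in>J. max 0 (a i \<bullet> (x - p))) = (\<Sum>i\<in>J. max 0 (a i \<bullet> x - \<beta> i))"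
      by (intro sum.cong) (auto simp: J_def inner_diff_right)
    also have "\<dots> \<le> (\<Sum>i\<in>I. max 0 (a i \<bullet> x - \<beta> i))"
      using I by (intro sum_mono2) (auto simp: J_def)
    also have "L (x - p) = L x - y" using p by (simp add: P_def L.diff)
    finally have le: "c J * norm (x - p) \<le> norm (L x - y) + (\<Sum>i\<in>I. max 0 (a i \<bullet> x - \<beta> i))"
      (is "_ \<le> ?R") by simp
    have cJ: "c J > 0" "1 / c J \<le> \<kappa>" using c(1) c_le by (auto simp: J_def)
    have "0 \<le> ?R" by (intro add_nonneg_nonneg sum_nonneg) auto
    then have "(1 / c J) * ?R \<le> \<kappa> * ?R" using cJ by (intro mult_right_mono)
    moreover have "norm (x - p) \<le> (1 / c J) * ?R" using le cJ(1) by (simp add: field_simps)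
    ultimately have "norm (x - p) \<le> \<kappa> * ?R" by linarith
    then show ?thesis using p unfolding P_def by (intro exI[of _ p]) (auto simp: dist_norm)
  qed
  ultimately show thesis by (rule that)
qed

section \<open>The l1 norm\<close>

lemma l1_norm_zero [simp]: "l1_norm 0 = 0"
  by (simp add: l1_norm_def)

lemma l1_norm_scaleR: "l1_norm (t *\<^sub>R x) = \<bar>t\<bar> * l1_norm x"
  by (simp add: l1_norm_def abs_mult sum_distrib_left)

lemma l1_norm_triangle: "l1_norm (x + y) \<le> l1_norm x + l1_norm y"
  unfolding l1_norm_def by (simp add: sum_mono abs_triangle_ineq flip: sum.distrib)

lemma l1_norm_convex_combination:
  assumes "0 \<le> t" "t \<le> 1"
  shows "l1_norm (x + t *\<^sub>R (u - x)) \<le> (1 - t) * l1_norm x + t * l1_norm u"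
proof -
  have "x + t *\<^sub>R (u - x) = (1 - t) *\<^sub>R x + t *\<^sub>R u" by (simp add: algebra_simps)
  then show ?thesis
    using l1_norm_triangle[of "(1 - t) *\<^sub>R x" "t *\<^sub>R u"] assms by (simp add: l1_norm_scaleR)
qed

lemma norm_le_l1_norm: "norm x \<le> l1_norm x"
  unfolding l1_norm_def by (rule norm_le_l1_cart)

lemma l1_norm_le_norm: "l1_norm (x :: real ^ 'n) \<le> real CARD('n) * norm x"
  unfolding l1_norm_def using sum_bounded_above[of UNIV "\<lambda>i. \<bar>x $ i\<bar>" "norm x"]
  by (simp add: component_le_norm_cart)

lemma continuous_on_l1_norm [continuous_intros]:
  "continuous_on S f \<Longrightarrow> continuous_on S (\<lambda>x. l1_norm (f x))"
  unfolding l1_norm_def by (intro continuous_intros)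

lemma l1_norm_add_axis:
  "l1_norm (x + c *\<^sub>R axis i 1) = l1_norm x - \<bar>x $ i\<bar> + \<bar>x $ i + c\<bar>"
proof -
  have "(\<Sum>j\<in>UNIV - {i}. \<bar>(x + c *\<^sub>R axis i 1) $ j\<bar>) = (\<Sum>j\<in>UNIV - {i}. \<bar>x $ j\<bar>)"
    by (intro sum.cong) (auto simp: axis_def)
  then show ?thesis
    unfolding l1_norm_def by (simp add: sum.remove[of UNIV i])
qed

text \<open>
  The sign vectors are the normals of the facets of the l1 unit ball; through them a bound on the
  l1 norm becomes a finite system of linear inequalities.
\<close>

definition sign_vec :: "'n set \<Rightarrow> real ^ 'n" where
  "sign_vec T = (\<chi> i. if i \<in> T then 1 else - 1)"

lemma sign_vec_le_l1_norm: "sign_vec T \<bullet> x \<le> l1_norm x"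
  unfolding l1_norm_def sign_vec_def inner_vec_def by (intro sum_mono) auto

lemma l1_norm_le_iff_sign_vec: "l1_norm x \<le> \<eta> \<longleftrightarrow> (\<forall>T. sign_vec T \<bullet> x \<le> \<eta>)"
proof
  assume "\<forall>T. sign_vec T \<bullet> x \<le> \<eta>"
  then have "sign_vec {i. 0 \<le> x $ i} \<bullet> x \<le> \<eta>" by blast
  moreover have "sign_vec {i. 0 \<le> x $ i} \<bullet> x = l1_norm x"
    unfolding l1_norm_def sign_vec_def inner_vec_def by (intro sum.cong) auto
  ultimately show "l1_norm x \<le> \<eta>" by simp
qed (meson order_trans sign_vec_le_l1_norm)

section \<open>Minimizers of the l1 norm on an affine subspace\<close>

definition l1_minimizers :: "real ^ 'n ^ 'm \<Rightarrow> real ^ 'm \<Rightarrow> (real ^ 'n) set" where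
  "l1_minimizers A y = {x. A *v x = y \<and> (\<forall>u. A *v u = y \<longrightarrow> l1_norm x \<le> l1_norm u)}"

text \<open>
  If \<open>\<eta>\<close> is the optimal value for \<open>y'\<close>, the minimizers for \<open>y'\<close> form the polyhedron given by
  \<open>A *v x = y'\<close> and \<open>sign_vec T \<bullet> x \<le> \<eta>\<close> for all \<open>T\<close>.  A minimizer for \<open>y\<close> violates these
  constraints by at most a multiple of \<open>dist y y'\<close>, because the optimal value is itself Lipschitz in
  \<open>y\<close>; Hoffman's bound turns the violation into a distance.
\<close>

theorem l1_minimizers_lipschitz:
  fixes A :: "real ^ 'n ^ 'm"
  obtains \<kappa> where "\<kappa> > 0"
    and "\<And>y y' x. \<lbrakk>x \<in> l1_minimizers A y; l1_minimizers A y' \<noteq> {}\<rbrakk> \<Longrightarrow>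
           \<exists>x'\<in>l1_minimizers A y'. dist x x' \<le> \<kappa> * dist y y'"
proof -
  \<comment> \<open>Without inequalities, the error bound is a bounded choice of preimages under \<open>A\<close>.\<close>
  obtain \<kappa>1 where \<kappa>1: "\<kappa>1 > 0"
    and preimage: "\<And>y x q. A *v q = y \<Longrightarrow> \<exists>p. A *v p = y \<and> dist x p \<le> \<kappa>1 * norm (A *v x - y)"
    by (rule hoffman_error_bound[where L = "(*v) A" and I = "{}"]) auto
  obtain \<kappa>2 where \<kappa>2: "\<kappa>2 > 0"
    and hoff: "\<And>y \<eta> x q. \<lbrakk>A *v q = y; \<forall>T\<in>UNIV. sign_vec T \<bullet> q \<le> \<eta> T\<rbrakk> \<Longrightarrow>
      \<exists>p. A *v p = y \<and> (\<forall>T\<in>UNIV. sign_vec T \<bullet> p \<le> \<eta> T) \<and>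
          dist x p \<le> \<kappa>2 * (norm (A *v x - y) + (\<Sum>T\<in>UNIV. max 0 (sign_vec T \<bullet> x - \<eta> T)))"
    by (rule hoffman_error_bound[where L = "(*v) A" and I = "UNIV :: 'n set set" and a = sign_vec])
       auto
  define C where "C = real CARD('n) * \<kappa>1"
  have C: "0 \<le> C" using \<kappa>1 by (simp add: C_def)
  define K where "K = \<kappa>2 * (1 + real CARD('n set) * C)"
  have "K > 0" unfolding K_def using \<kappa>2 C by (intro mult_pos_pos add_pos_nonneg) auto
  moreover have "\<exists>x'\<in>l1_minimizers A y'. dist x x' \<le> K * dist y y'"
    if x: "x \<in> l1_minimizers A y" and ne: "l1_minimizers A y' \<noteq> {}" for y y' x
  proof -
    obtain q where q: "q \<in> l1_minimizers A y'" using ne by blast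
    then have Aq: "A *v q = y'" by (simp add: l1_minimizers_def)
    have Ax: "A *v x = y" using x by (simp add: l1_minimizers_def)
    \<comment> \<open>Moving from \<open>q\<close> along a short preimage of \<open>y - y'\<close> gives a competitor for \<open>x\<close>.\<close>
    have value_le: "l1_norm x - l1_norm q \<le> C * dist y y'"
    proof -
      have "A *v (x - q) = y - y'" using Ax Aq by (simp add: matrix_vector_mult_diff_distrib)
      from preimage[OF this, of 0] obtain w where w: "A *v w = y - y'" "norm w \<le> \<kappa>1 * dist y y'"
        by (auto simp: dist_norm norm_minus_commute)
      have "l1_norm x \<le> l1_norm (q + w)"
        using x w Aq by (auto simp: l1_minimizers_def matrix_vector_right_distrib)
      also have "\<dots> \<le> l1_norm q + l1_norm w" by (rule l1_norm_triangle)
      also have "l1_norm w \<le> real CARD('n) * norm w" by (rule l1_norm_le_norm)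
      also have "\<dots> \<le> C * dist y y'"
        unfolding C_def using w(2) by (simp add: mult.assoc mult_left_mono)
      finally show ?thesis by simp
    qed
    obtain p where p: "A *v p = y'" "\<forall>T\<in>UNIV. sign_vec T \<bullet> p \<le> l1_norm q"
      and dist_p: "dist x p \<le> \<kappa>2 * (norm (A *v x - y') +
          (\<Sum>T\<in>UNIV. max 0 (sign_vec T \<bullet> x - l1_norm q)))"
      using hoff[of q y' "\<lambda>_. l1_norm q" x] Aq sign_vec_le_l1_norm by blast
    have "l1_norm p \<le> l1_norm q" using p(2) by (simp add: l1_norm_le_iff_sign_vec)
    then have "p \<in> l1_minimizers A y'" using p(1) q by (fastforce simp: l1_minimizers_def)
    moreover have "dist x p \<le> K * dist y y'"
    proof -
      have "max 0 (sign_vec T \<bullet> x - l1_norm q) \<le> C * dist y y'" for T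
        using value_le sign_vec_le_l1_norm[of T x] C by (simp add: max_def)
      then have "(\<Sum>T\<in>(UNIV :: 'n set set). max 0 (sign_vec T \<bullet> x - l1_norm q))
                 \<le> real CARD('n set) * (C * dist y y')"
        by (intro sum_bounded_above) 
      then have "norm (A *v x - y') + (\<Sum>T\<in>UNIV. max 0 (sign_vec T \<bullet> x - l1_norm q))
                 \<le> (1 + real CARD('n set) * C) * dist y y'"
        using Ax by (simp add: dist_norm algebra_simps)
      then have "\<kappa>2 * (norm (A *v x - y') + (\<Sum>T\<in>UNIV. max 0 (sign_vec T \<bullet> x - l1_norm q)))
                 \<le> K * dist y y'"
        unfolding K_def mult.assoc using \<kappa>2 by (intro mult_left_mono) auto
      with dist_p show ?thesis by (rule order_trans)
    qed
    ultimately show ?thesis by blast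
  qed
  ultimately show thesis by (rule that)
qed

section \<open>From fits to solutions\<close>

lemma sol_map_iff:
  "x \<in> sol_map A h (b, l) \<longleftrightarrow>
     (\<forall>u. h (A *v x - b) + l * l1_norm x \<le> h (A *v u - b) + l * l1_norm u)"
  unfolding sol_map_def is_arg_min_def by (auto simp: not_less)

text \<open>
  Solutions with a common fit share the loss term, so they are distinguished by the penalty alone.
\<close>

lemma sol_map_eq_l1_minimizers:
  assumes "0 < l" and x: "x \<in> sol_map A h (b, l)"
    and unique: "\<And>x'. x' \<in> sol_map A h (b, l) \<Longrightarrow> A *v x' = A *v x"
  shows "sol_map A h (b, l) = l1_minimizers A (A *v x)"
proof (intro equalityI subsetI)
  fix v assume v: "v \<in> sol_map A h (b, l)"
  then have "A *v v = A *v x" by (rule unique)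
  moreover have "l1_norm v \<le> l1_norm u" if "A *v u = A *v x" for u
    using v \<open>A *v v = A *v x\<close> that \<open>0 < l\<close> unfolding sol_map_iff by (metis add_le_cancel_left mult_le_cancel_left_pos)
  ultimately show "v \<in> l1_minimizers A (A *v x)" by (simp add: l1_minimizers_def)
next
  fix v assume v: "v \<in> l1_minimizers A (A *v x)"
  then have "A *v v = A *v x" "l1_norm v \<le> l1_norm x" by (auto simp: l1_minimizers_def)
  then have "h (A *v v - b) + l * l1_norm v \<le> h (A *v x - b) + l * l1_norm x"
    using \<open>0 < l\<close> by simp
  then show "v \<in> sol_map A h (b, l)" using x unfolding sol_map_iff by (meson order_trans)
qed

lemma hausdorff_lipschitz_onI:
  assumes "\<kappa> > 0"
    and near: "\<And>z z' x. \<lbrakk>z \<in> D; z' \<in> D; x \<in> F z\<rbrakk> \<Longrightarrow> \<exists>x'\<in>F z'. dist x x' \<le> \<kappa> * dist z z'"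
  shows "hausdorff_lipschitz_on D F"
proof -
  have "excess (F z) (F z') \<le> ennreal (\<kappa> * dist z z')" if z: "z \<in> D" "z' \<in> D" for z z'
    unfolding excess_def point_dist_def
  proof (rule SUP_least)
    fix x assume "x \<in> F z"
    then obtain x' where "x' \<in> F z'" "dist x x' \<le> \<kappa> * dist z z'" using near[OF z] by blast
    then show "(INF y\<in>F z'. ennreal (dist x y)) \<le> ennreal (\<kappa> * dist z z')"
      by (intro INF_lower2[of x']) (auto intro: ennreal_leI)
  qed
  then show ?thesis
    unfolding hausdorff_lipschitz_on_def hausdorff_dist_def using \<open>\<kappa> > 0\<close>
    by (metis dist_commute max.boundedI)
qed

text \<open>
  Lipschitz dependence of the fit on the parameter is enough for the solution set: the latter is the
  set of l1 minimizers over the fibre of the fit.  With \<open>z = z'\<close> the assumption on the fits also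
  says that the fit is unique.
\<close>

theorem sol_map_lipschitz:
  fixes A :: "real ^ 'n ^ 'm"
  assumes pos: "\<And>z. z \<in> D \<Longrightarrow> 0 < snd z"
    and ne: "\<And>z. z \<in> D \<Longrightarrow> sol_map A h z \<noteq> {}"
    and fit: "\<And>z z' x x'. \<lbrakk>z \<in> D; z' \<in> D; x \<in> sol_map A h z; x' \<in> sol_map A h z'\<rbrakk> \<Longrightarrow>
                dist (A *v x) (A *v x') \<le> \<kappa> * dist z z'"
  shows "hausdorff_lipschitz_on D (sol_map A h)"
proof -
  obtain K where "K > 0"
    and K: "\<And>y y' x. \<lbrakk>x \<in> l1_minimizers A y; l1_minimizers A y' \<noteq> {}\<rbrakk> \<Longrightarrow>
           \<exists>x'\<in>l1_minimizers A y'. dist x x' \<le> K * dist y y'"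
    by (rule l1_minimizers_lipschitz[of A], rule that)
  have eq: "sol_map A h z = l1_minimizers A (A *v x)" if z: "z \<in> D" "x \<in> sol_map A h z" for z x
  proof (cases z)
    case (Pair b l)
    show ?thesis
      unfolding Pair
    proof (rule sol_map_eq_l1_minimizers)
      show "0 < l" using pos[OF z(1)] Pair by simp
      show "x \<in> sol_map A h (b, l)" using z(2) Pair by simp
      show "A *v x' = A *v x" if "x' \<in> sol_map A h (b, l)" for x'
        using fit[OF z(1) z(1), of x' x] that z(2) Pair by simp
    qed
  qed
  have "\<exists>x'\<in>sol_map A h z'. dist x x' \<le> K * max 1 \<kappa> * dist z z'"
    if z: "z \<in> D" "z' \<in> D" and x: "x \<in> sol_map A h z" for z z' x
  proof -
    obtain q where q: "q \<in> sol_map A h z'" using ne z(2) by blast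
    have "x \<in> l1_minimizers A (A *v x)" using eq[OF z(1) x] x by blast
    moreover have "l1_minimizers A (A *v q) \<noteq> {}" using eq[OF z(2) q] q by blast
    ultimately obtain x' where x': "x' \<in> sol_map A h z'" "dist x x' \<le> K * dist (A *v x) (A *v q)"
      using K eq[OF z(2) q] by metis
    have "dist (A *v x) (A *v q) \<le> \<kappa> * dist z z'" by (rule fit[OF z x q])
    \<comment> \<open>The constant \<open>\<kappa>\<close> may be zero or negative, a Lipschitz modulus may not.\<close>
    also have "\<dots> \<le> max 1 \<kappa> * dist z z'" by (intro mult_right_mono) auto
    finally have "K * dist (A *v x) (A *v q) \<le> K * (max 1 \<kappa> * dist z z')"
      using \<open>K > 0\<close> by simp
    with x'(2) have "dist x x' \<le> K * max 1 \<kappa> * dist z z'" unfolding mult.assoc by (rule order_trans)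
    with x'(1) show ?thesis by (rule bexI[rotated])
  qed
  then show ?thesis using \<open>K > 0\<close> by (intro hausdorff_lipschitz_onI[of "K * max 1 \<kappa>"]) auto
qed

lemma hausdorff_dist_singletons: "hausdorff_dist {x} {y} = ennreal (dist x y)"
  by (simp add: hausdorff_dist_def excess_def point_dist_def dist_commute)

theorem sol_map_lipschitz_if_fit_map_lipschitz:
  assumes U: "U \<subseteq> UNIV \<times> {0<..}" and single: "single_valued_map_on U (fit_map A h)"
    and lip: "hausdorff_lipschitz_on U (fit_map A h)"
  shows "hausdorff_lipschitz_on U (sol_map A h)"
proof -
  obtain \<kappa> where \<kappa>: "\<kappa> > 0" "\<And>z z'. \<lbrakk>z \<in> U; z' \<in> U\<rbrakk> \<Longrightarrow>
      hausdorff_dist (fit_map A h z) (fit_map A h z') \<le> ennreal (\<kappa> * dist z z')"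
    using lip unfolding hausdorff_lipschitz_on_def by blast
  have fit_eq: "fit_map A h z = {A *v x}" if "z \<in> U" "x \<in> sol_map A h z" for z x
  proof -
    have "A *v x \<in> fit_map A h z" using that by (auto simp: fit_map_def)
    then show ?thesis
      using single that(1) unfolding single_valued_map_on_def by (metis is_singletonE singletonD)
  qed
  show ?thesis
  proof (rule sol_map_lipschitz)
    show "0 < snd z" if "z \<in> U" for z using that U by auto
    show "sol_map A h z \<noteq> {}" if "z \<in> U" for z
      using single that unfolding single_valued_map_on_def fit_map_def is_singleton_def by force
    show "dist (A *v x) (A *v x') \<le> \<kappa> * dist z z'"
      if "z \<in> U" "z' \<in> U" "x \<in> sol_map A h z" "x' \<in> sol_map A h z'" for z z' x x'
      using \<kappa>(2)[OF that(1,2)] \<kappa>(1) fit_eq that by (simp add: hausdorff_dist_singletons)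
  qed
qed

section \<open>Gradients of convex functions\<close>

lemma GDERIV_unique:
  assumes "GDERIV h x :> g" "GDERIV h x :> g'"
  shows "g = g'"
proof -
  have "(\<lambda>v. v \<bullet> g) = (\<lambda>v. v \<bullet> g')" using assms unfolding gderiv_def by (rule has_derivative_unique)
  then show ?thesis by (metis vector_eq_ldot)
qed

lemma GDERIV_grad:
  fixes h :: "'a::euclidean_space \<Rightarrow> real"
  assumes "h differentiable (at x)"
  shows "GDERIV h x :> grad h x"
proof -
  obtain h' where h': "(h has_derivative h') (at x)" using assms unfolding differentiable_def by blast
  then have "linear h'" by (rule has_derivative_linear)
  then have "h' = (\<lambda>v. v \<bullet> adjoint h' 1)" by (auto simp: adjoint_works)
  then have "GDERIV h x :> adjoint h' 1" using h' unfolding gderiv_def by simp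
  then show ?thesis unfolding grad_def by (rule theI) (rule GDERIV_unique[OF _ \<open>GDERIV h x :> _\<close>])
qed

lemma GDERIV_directional:
  assumes "GDERIV h x :> g"
  shows "((\<lambda>t. (h (x + t *\<^sub>R v) - h x) / t) \<longlongrightarrow> v \<bullet> g) (at_right 0)"
proof -
  have "((\<lambda>t. h (x + t *\<^sub>R v)) has_derivative (\<lambda>s. (s *\<^sub>R v) \<bullet> g)) (at 0)"
    using assms unfolding gderiv_def
    by (intro has_derivative_compose[where f = "\<lambda>t. x + t *\<^sub>R v" and g = h])
       (auto intro!: derivative_eq_intros)
  then have "((\<lambda>t. h (x + t *\<^sub>R v)) has_real_derivative v \<bullet> g) (at 0)"
    unfolding has_field_derivative_def by (simp add: mult.commute[of _ "v \<bullet> g"])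
  then have "((\<lambda>t. (h (x + t *\<^sub>R v) - h x) / t) \<longlongrightarrow> v \<bullet> g) (at 0)"
    by (simp add: DERIV_def)
  then show ?thesis by (rule filterlim_mono) (auto simp: at_within_le_at)
qed

text \<open>
  The difference quotients of \<open>h\<close> along the segment from \<open>x\<close> to \<open>y\<close> are at most \<open>h y - h x\<close> by
  convexity, and they tend to the directional derivative.
\<close>

lemma convex_on_imp_above_gradient:
  assumes "convex_on UNIV h" and "GDERIV h x :> g"
  shows "h y \<ge> h x + (y - x) \<bullet> g"
proof -
  have "(y - x) \<bullet> g \<le> h y - h x"
  proof (rule tendsto_upperbound[OF GDERIV_directional[OF assms(2)]])
    show "eventually (\<lambda>t. (h (x + t *\<^sub>R (y - x)) - h x) / t \<le> h y - h x) (at_right 0)"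
    proof (rule eventually_at_rightI[of 0 1])
      fix t :: real assume t: "t \<in> {0<..<1}"
      have "h ((1 - t) *\<^sub>R x + t *\<^sub>R y) \<le> (1 - t) * h x + t * h y"
        using convex_onD[OF assms(1)] t by auto
      moreover have "(1 - t) *\<^sub>R x + t *\<^sub>R y = x + t *\<^sub>R (y - x)" by (simp add: algebra_simps)
      ultimately show "(h (x + t *\<^sub>R (y - x)) - h x) / t \<le> h y - h x"
        using t by (simp add: field_simps)
    qed simp
  qed simp
  then show ?thesis by simp
qed

section \<open>First-order optimality and the support of solutions\<close>

text \<open>
  The inclusion \<open>- A\<^sup>T g \<in> \<partial>(l * l1_norm) x\<close>, obtained from a small step from \<open>x\<close> towards \<open>u\<close>: the
  smooth part contributes its directional derivative, the penalty is bounded by convexity.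
\<close>

lemma sol_map_optimality:
  assumes x: "x \<in> sol_map A h (b, l)" and "0 \<le> l" and g: "GDERIV h (A *v x - b) :> g"
  shows "l * l1_norm x \<le> l * l1_norm u + (A *v (u - x)) \<bullet> g"
proof -
  have "- (l * (l1_norm u - l1_norm x)) \<le> (A *v (u - x)) \<bullet> g"
  proof (rule tendsto_lowerbound[OF GDERIV_directional[OF g]])
    show "eventually (\<lambda>t. - (l * (l1_norm u - l1_norm x))
            \<le> (h (A *v x - b + t *\<^sub>R (A *v (u - x))) - h (A *v x - b)) / t) (at_right 0)"
    proof (rule eventually_at_rightI[of 0 1])
      fix t :: real assume t: "t \<in> {0<..<1}"
      have "A *v (x + t *\<^sub>R (u - x)) - b = A *v x - b + t *\<^sub>R (A *v (u - x))"
        by (simp add: matrix_vector_right_distrib matrix_vector_mult_scaleR)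
      then have "h (A *v x - b) + l * l1_norm x
          \<le> h (A *v x - b + t *\<^sub>R (A *v (u - x))) + l * l1_norm (x + t *\<^sub>R (u - x))"
        using x unfolding sol_map_iff by metis
      also have "l * l1_norm (x + t *\<^sub>R (u - x)) \<le> l * ((1 - t) * l1_norm x + t * l1_norm u)"
        using t \<open>0 \<le> l\<close> by (intro mult_left_mono l1_norm_convex_combination) auto
      finally show "- (l * (l1_norm u - l1_norm x))
            \<le> (h (A *v x - b + t *\<^sub>R (A *v (u - x))) - h (A *v x - b)) / t"
        using t by (simp add: field_simps)
    qed simp
  qed simp
  then show ?thesis by (simp add: algebra_simps)
qed

lemma sol_map_optimality_coordinate:
  assumes "x \<in> sol_map A h (b, l)" and "0 \<le> l" and "GDERIV h (A *v x - b) :> g"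
  shows "l * \<bar>x $ i\<bar> \<le> l * \<bar>x $ i + c\<bar> + c * (column i A \<bullet> g)"
  using sol_map_optimality[OF assms, of "x + c *\<^sub>R axis i 1"]
  by (simp add: l1_norm_add_axis matrix_vector_mult_scaleR matrix_vector_mult_basis algebra_simps)

lemma column_gradient_le:
  assumes "x \<in> sol_map A h (b, l)" and "0 \<le> l" and "GDERIV h (A *v x - b) :> g"
  shows "\<bar>column i A \<bullet> g\<bar> \<le> l"
proof -
  have "l * \<bar>x $ i + c\<bar> \<le> l * \<bar>x $ i\<bar> + l * \<bar>c\<bar>" for c
    using \<open>0 \<le> l\<close> by (metis abs_triangle_ineq distrib_left mult_left_mono)
  from this[of 1] this[of "- 1"] show ?thesis
    using sol_map_optimality_coordinate[OF assms, of i 1]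
      sol_map_optimality_coordinate[OF assms, of i "- 1"] by simp
qed

text \<open>
  Changing the coordinate \<open>x $ i\<close> to \<open>0\<close> saves \<open>l * \<bar>x $ i\<bar>\<close> in the penalty, but costs at most
  \<open>\<bar>column i A \<bullet> g\<bar> * \<bar>x $ i\<bar>\<close> to first order.
\<close>

lemma sol_map_coordinate_eq_0:
  assumes "x \<in> sol_map A h (b, l)" and "0 \<le> l" and "GDERIV h (A *v x - b) :> g"
    and less: "\<bar>column i A \<bullet> g\<bar> < l"
  shows "x $ i = 0"
proof (rule ccontr)
  assume ne: "x $ i \<noteq> 0"
  have "l * \<bar>x $ i\<bar> \<le> - (x $ i * (column i A \<bullet> g))"
    using sol_map_optimality_coordinate[OF assms(1-3), of i "- x $ i"] by simp
  also have "\<dots> \<le> \<bar>x $ i\<bar> * \<bar>column i A \<bullet> g\<bar>" by (metis abs_ge_minus_self abs_mult)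
  also have "\<dots> < \<bar>x $ i\<bar> * l" using less ne by simp
  finally show False by (simp add: mult.commute)
qed

lemma matrix_vector_mult_in_rge_cols:
  fixes A :: "real ^ 'n ^ 'm"
  assumes "\<And>i. i \<notin> J \<Longrightarrow> x $ i = 0"
  shows "A *v x \<in> rge_cols A J"
proof -
  have "A *v x = (\<Sum>i\<in>UNIV. x $ i *\<^sub>R column i A)"
    by (simp add: matrix_mult_sum scalar_mult_eq_scaleR)
  also have "\<dots> = (\<Sum>i\<in>J. x $ i *\<^sub>R column i A)"
    using assms by (intro sum.mono_neutral_right) auto
  finally show ?thesis unfolding rge_cols_def by blast
qed

lemma subspace_rge_cols: "subspace (rge_cols A J)"
  unfolding rge_cols_def
proof (rule subspaceI)
  show "0 \<in> range (\<lambda>c. \<Sum>i\<in>J. c i *\<^sub>R column i A)"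
    by (rule range_eqI[of _ _ "\<lambda>_. 0"]) simp
next
  fix x y assume "x \<in> range (\<lambda>c. \<Sum>i\<in>J. c i *\<^sub>R column i A)" "y \<in> range (\<lambda>c. \<Sum>i\<in>J. c i *\<^sub>R column i A)"
  then obtain c d where "x = (\<Sum>i\<in>J. c i *\<^sub>R column i A)" "y = (\<Sum>i\<in>J. d i *\<^sub>R column i A)" by blast
  then show "x + y \<in> range (\<lambda>c. \<Sum>i\<in>J. c i *\<^sub>R column i A)"
    by (intro range_eqI[of _ _ "\<lambda>i. c i + d i"]) (simp add: scaleR_left_distrib sum.distrib)
next
  fix k x assume "x \<in> range (\<lambda>c. \<Sum>i\<in>J. c i *\<^sub>R column i A)"
  then obtain c where "x = (\<Sum>i\<in>J. c i *\<^sub>R column i A)" by blast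
  then show "k *\<^sub>R x \<in> range (\<lambda>c. \<Sum>i\<in>J. c i *\<^sub>R column i A)"
    by (intro range_eqI[of _ _ "\<lambda>i. k * c i"]) (simp add: scaleR_sum_right)
qed

section \<open>The Hessian of a convex function\<close>

lemma gradient_cyclically_monotone:
  fixes h :: "'a::euclidean_space \<Rightarrow> real"
  assumes "convex_on UNIV h" and "h differentiable (at p)" "h differentiable (at q)" "h differentiable (at r)"
  shows "(q - p) \<bullet> grad h p + (r - q) \<bullet> grad h q + (p - r) \<bullet> grad h r \<le> 0"
  using convex_on_imp_above_gradient[OF assms(1) GDERIV_grad[OF assms(2)], of q]
    convex_on_imp_above_gradient[OF assms(1) GDERIV_grad[OF assms(3)], of r]
    convex_on_imp_above_gradient[OF assms(1) GDERIV_grad[OF assms(4)], of p] by simp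

text \<open>
  The inequality for the gradient along the cycle \<open>r\<close>, \<open>r + t *\<^sub>R u\<close>, \<open>r + t *\<^sub>R v\<close>, divided by
  \<open>t\<^sup>2\<close> in the limit \<open>t \<rightarrow> 0\<close>; the terms with \<open>grad h r\<close> cancel around the cycle.  The case
  \<open>u = 0\<close> is positive semidefiniteness.  Cycles of length three replace the symmetry of second
  derivatives in what follows.
\<close>

lemma gradient_derivative_cyclically_monotone:
  fixes h :: "'a::euclidean_space \<Rightarrow> real"
  assumes convex: "convex_on UNIV h" and V: "open V" "r \<in> V" "\<And>y. y \<in> V \<Longrightarrow> h differentiable (at y)"
    and Q: "(grad h has_derivative Q) (at r)"
  shows "(v - u) \<bullet> Q u \<le> v \<bullet> Q v"
proof -
  define F where "F t = (v - u) \<bullet> grad h (r + t *\<^sub>R u) - v \<bullet> grad h (r + t *\<^sub>R v)" for t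
  interpret Q: bounded_linear Q using Q by (rule has_derivative_bounded_linear)
  have "((\<lambda>t. grad h (r + t *\<^sub>R w)) has_derivative (\<lambda>s. Q (s *\<^sub>R w))) (at 0)" for w
    using Q by (intro has_derivative_compose[where f = "\<lambda>t. r + t *\<^sub>R w" and g = "grad h"])
       (auto intro!: derivative_eq_intros)
  then have "(F has_derivative (\<lambda>s. (v - u) \<bullet> Q (s *\<^sub>R u) - v \<bullet> Q (s *\<^sub>R v))) (at 0)"
    unfolding F_def by (intro has_derivative_diff has_derivative_inner_right)
  then have "(F has_real_derivative ((v - u) \<bullet> Q u - v \<bullet> Q v)) (at 0)"
    unfolding has_field_derivative_def
    by (rule has_derivative_eq_rhs) (auto simp: Q.scaleR algebra_simps)
  then have "((\<lambda>t. (F t - F 0) / t) \<longlongrightarrow> (v - u) \<bullet> Q u - v \<bullet> Q v) (at 0)"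
    by (simp add: DERIV_def)
  then have lim: "((\<lambda>t. (F t - F 0) / t) \<longlongrightarrow> (v - u) \<bullet> Q u - v \<bullet> Q v) (at_right 0)"
    by (rule filterlim_mono) (auto simp: at_within_le_at)
  have "eventually (\<lambda>t. r + t *\<^sub>R w \<in> V) (at_right 0)" for w
  proof (rule topological_tendstoD[OF _ V(1)])
    show "((\<lambda>t. r + t *\<^sub>R w) \<longlongrightarrow> r + 0 *\<^sub>R w) (at_right 0)" by (intro tendsto_intros)
  qed (use V in simp)
  from this[of u] this[of v] eventually_at_right_less[of 0]
  have "eventually (\<lambda>t. (F t - F 0) / t \<le> 0) (at_right 0)"
  proof eventually_elim
    case (elim t)
    have "(r + t *\<^sub>R u - r) \<bullet> grad h r + (r + t *\<^sub>R v - (r + t *\<^sub>R u)) \<bullet> grad h (r + t *\<^sub>R u)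
        + (r - (r + t *\<^sub>R v)) \<bullet> grad h (r + t *\<^sub>R v) \<le> 0"
      using elim V by (intro gradient_cyclically_monotone convex) auto
    moreover have "r + t *\<^sub>R u - r = t *\<^sub>R u" "r + t *\<^sub>R v - (r + t *\<^sub>R u) = t *\<^sub>R (v - u)"
        "r - (r + t *\<^sub>R v) = - (t *\<^sub>R v)"
      by (simp_all add: algebra_simps)
    ultimately have "t * (F t - F 0) \<le> 0"
      unfolding F_def by (simp add: algebra_simps)
    then show ?case using elim by (simp add: divide_le_0_iff mult_le_0_iff)
  qed
  from tendsto_upperbound[OF lim this] show ?thesis by simp
qed

lemma linear_coefficient_eq_0:
  fixes a b :: real
  assumes "\<And>s. 0 \<le> s * a + s\<^sup>2 * b"
  shows "a = 0"
proof (rule ccontr)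
  assume "a \<noteq> 0"
  define e where "e = 1 / (2 * (\<bar>b\<bar> + 1))"
  have e: "e > 0" "e * b < 1" unfolding e_def by (auto simp: field_simps)
  have "0 \<le> (- (e * a)) * a + (- (e * a))\<^sup>2 * b" by (rule assms)
  also have "\<dots> = e * a\<^sup>2 * (e * b - 1)" by (simp add: power2_eq_square algebra_simps)
  also have "\<dots> < 0" using e \<open>a \<noteq> 0\<close> by (intro mult_pos_neg) auto
  finally show False by simp
qed

text \<open>
  For a symmetric positive semidefinite form this is the Cauchy-Schwarz inequality.  Positive
  semidefiniteness alone does not suffice, as a rotation by a right angle shows.  Three-point
  monotonicity at \<open>v\<close> and \<open>v + s *\<^sub>R w\<close> with small \<open>s\<close> of either sign yields \<open>v \<bullet> Q w = 0\<close>;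
  semidefiniteness at \<open>v + s *\<^sub>R w\<close> then yields \<open>w \<bullet> Q v = 0\<close>.
\<close>

lemma isotropic_in_kernel_if_cyclically_monotone:
  fixes Q :: "'a::real_inner \<Rightarrow> 'a"
  assumes "linear Q" and cyc: "\<And>u v. (v - u) \<bullet> Q u \<le> v \<bullet> Q v" and v: "v \<bullet> Q v = 0"
  shows "Q v = 0"
proof -
  interpret linear Q by fact
  define w where "w = Q v"
  have "v \<bullet> Q w = 0"
  proof (rule linear_coefficient_eq_0)
    show "0 \<le> s * (v \<bullet> Q w) + s\<^sup>2 * (w \<bullet> Q w)" for s
      using cyc[of "v + s *\<^sub>R w" v] v
      by (simp add: add scale inner_add_left inner_add_right power2_eq_square algebra_simps)
  qed
  have "w \<bullet> Q v = 0"
  proof (rule linear_coefficient_eq_0)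
    show "0 \<le> s * (w \<bullet> Q v) + s\<^sup>2 * (w \<bullet> Q w)" for s
      using cyc[where u = 0 and v = "v + s *\<^sub>R w"] v \<open>v \<bullet> Q w = 0\<close>
      by (simp add: add scale zero inner_add_left inner_add_right power2_eq_square mult.assoc)
  qed
  then show ?thesis by (simp add: w_def)
qed

lemma positive_definite_on_subspace:
  fixes Q :: "'a::euclidean_space \<Rightarrow> 'a"
  assumes "linear Q" and cyc: "\<And>u v. (v - u) \<bullet> Q u \<le> v \<bullet> Q v"
    and W: "subspace W" and ker: "\<And>v. v \<in> W \<Longrightarrow> Q v = 0 \<Longrightarrow> v = 0"
  obtains c where "c > 0" "\<And>v. v \<in> W \<Longrightarrow> c * (norm v)\<^sup>2 \<le> v \<bullet> Q v"
proof -
  interpret linear Q by fact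
  have pos: "v \<bullet> Q v > 0" if "v \<in> W" "norm v = 1" for v
  proof -
    have "v \<bullet> Q v \<ge> 0" using cyc[where u = 0 and v = v] by (simp add: zero)
    moreover have "v \<bullet> Q v \<noteq> 0"
      using isotropic_in_kernel_if_cyclically_monotone[OF \<open>linear Q\<close> cyc] ker that by fastforce
    ultimately show ?thesis by simp
  qed
  have "\<exists>c>0. \<forall>v\<in>W \<inter> sphere 0 1. c \<le> v \<bullet> Q v"
  proof (cases "W \<inter> sphere 0 1 = {}")
    case True
    then show ?thesis by (intro exI[of _ 1]) auto
  next
    case False
    have "compact (W \<inter> sphere 0 1)" using closed_subspace[OF W] by (simp add: closed_Int_compact)
    moreover have "continuous_on (W \<inter> sphere 0 1) (\<lambda>v. v \<bullet> Q v)"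
      using \<open>linear Q\<close> by (intro continuous_intros linear_continuous_on linear_conv_bounded_linear[THEN iffD1])
    ultimately obtain v0 where "v0 \<in> W \<inter> sphere 0 1" "\<forall>v\<in>W \<inter> sphere 0 1. v0 \<bullet> Q v0 \<le> v \<bullet> Q v"
      using continuous_attains_inf[OF _ False] by blast
    then show ?thesis using pos[of v0] by (intro exI[of _ "v0 \<bullet> Q v0"]) auto
  qed
  then obtain c where c: "c > 0" "\<And>v. v \<in> W \<Longrightarrow> norm v = 1 \<Longrightarrow> c \<le> v \<bullet> Q v" by auto
  have "c * (norm v)\<^sup>2 \<le> v \<bullet> Q v" if "v \<in> W" for v
  proof (cases "v = 0")
    case False
    have "c \<le> ((1 / norm v) *\<^sub>R v) \<bullet> Q ((1 / norm v) *\<^sub>R v)"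
      using that False W by (intro c subspace_scale) auto
    then show ?thesis using False by (simp add: scale field_simps power2_eq_square)
  qed simp
  with c(1) show thesis by (rule that)
qed

text \<open>
  Strict differentiability: the increments between any two points near \<open>r\<close> are approximated by
  the derivative at \<open>r\<close>.  For a gradient this gives a local Lipschitz bound and, where the Hessian
  is positive definite, strong monotonicity.
\<close>

lemma strictly_differentiable_if_continuous_jacobian:
  fixes G :: "real ^ 'n \<Rightarrow> real ^ 'm"
  assumes V: "open V" "r \<in> V" and diff: "\<And>y. y \<in> V \<Longrightarrow> G differentiable (at y)"
    and cont: "continuous_on V (\<lambda>y. jacobian G (at y))" and "\<epsilon> > 0"
  obtains \<delta> where "\<delta> > 0" "ball r \<delta> \<subseteq> V"
    "\<And>p q. p \<in> ball r \<delta> \<Longrightarrow> q \<in> ball r \<delta> \<Longrightarrow>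
       norm (G p - G q - jacobian G (at r) *v (p - q)) \<le> \<epsilon> * norm (p - q)"
proof -
  define J where "J y = jacobian G (at y)" for y
  define f where "f y = (\<Sum>i\<in>UNIV. \<Sum>j\<in>UNIV. \<bar>(J y - J r) $ i $ j\<bar>)" for y
  have contJ: "continuous_on V J" using cont unfolding J_def .
  have "continuous_on V f" unfolding f_def by (intro continuous_intros contJ)
  then have "isCont f r" using V by (simp add: continuous_on_eq_continuous_at)
  then have "(f \<longlongrightarrow> f r) (nhds r)" by (simp add: continuous_at tendsto_at_iff_tendsto_nhds)
  moreover have "f r < \<epsilon>" unfolding f_def using \<open>\<epsilon> > 0\<close> by simp
  ultimately have "eventually (\<lambda>y. f y < \<epsilon>) (nhds r)" by (rule order_tendstoD(2))
  then have "eventually (\<lambda>y. f y < \<epsilon> \<and> y \<in> V) (nhds r)"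
    using V by (intro eventually_conj eventually_nhds_in_open)
  then obtain \<delta> where \<delta>: "\<delta> > 0" "\<And>y. dist y r < \<delta> \<Longrightarrow> f y < \<epsilon> \<and> y \<in> V"
    unfolding eventually_nhds_metric by blast
  have deriv: "(G has_derivative (\<lambda>v. J y *v v)) (at y within ball r \<delta>)" if "y \<in> ball r \<delta>" for y
    using diff[of y] \<delta>(2)[of y] that unfolding J_def jacobian_works[symmetric]
    by (auto simp: dist_commute jacobian_works intro: has_derivative_at_withinI)
  have "norm (G p - G q - J r *v (p - q)) \<le> \<epsilon> * norm (p - q)"
    if "p \<in> ball r \<delta>" "q \<in> ball r \<delta>" for p q
  proof -
    have "norm (G p - G q - J r *v (p - q)) \<le> norm (p - q) * \<epsilon>"
    proof (rule differentiable_bound_linearization[where f' = "\<lambda>y. (*v) (J y)" and ?x0.0 = r])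
      show "q + t *\<^sub>R (p - q) \<in> ball r \<delta>" if "t \<in> {0..1}" for t
      proof -
        have "(1 - t) *\<^sub>R q + t *\<^sub>R p \<in> ball r \<delta>"
          using \<open>p \<in> _\<close> \<open>q \<in> _\<close> that by (intro convexD convex_ball) auto
        then show ?thesis by (simp add: algebra_simps)
      qed
      show "(G has_derivative (*v) (J y)) (at y within ball r \<delta>)" if "y \<in> ball r \<delta>" for y
        using deriv[OF that] .
      show "onorm ((*v) (J y) - (*v) (J r)) \<le> \<epsilon>" if "y \<in> ball r \<delta>" for y
      proof -
        have "(*v) (J y) - (*v) (J r) = (*v) (J y - J r)"
          by (auto simp: matrix_vector_mult_diff_rdistrib)
        then have "onorm ((*v) (J y) - (*v) (J r)) \<le> f y"
          unfolding f_def by (simp only: onorm_le_matrix_component_sum)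
        also have "\<dots> \<le> \<epsilon>" using \<delta>(2)[of y] that by (auto simp: dist_commute)
        finally show ?thesis .
      qed
    qed (use \<delta> in auto)
    then show ?thesis by (simp add: mult.commute)
  qed
  moreover have "ball r \<delta> \<subseteq> V" using \<delta>(2) by (auto simp: dist_commute)
  ultimately show thesis using that[OF \<delta>(1)] unfolding J_def by blast
qed

section \<open>Local Lipschitz continuity of the fit\<close>

text \<open>
  The quantitative heart of the local result, for solutions whose fits are already known to be close
  to \<open>A *v x0\<close>.  Indices outside \<open>J\<close> stay strictly inactive nearby, so the difference \<open>w\<close> of two fits
  lies in the range of the columns in \<open>J\<close>, where the Hessian is positive definite.  Monotonicity of
  the subdifferential of the l1 norm gives
  \<open>w \<bullet> (l' *\<^sub>R G r - l *\<^sub>R G r') \<le> 0\<close> at the residuals \<open>r\<close> and \<open>r'\<close>.  Strong monotonicity of the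
  gradient \<open>G\<close> along \<open>w\<close> turns this into a bound of \<open>norm w\<close> by the change of the parameters.
\<close>

lemma local_fit_estimate:
  fixes A :: "real ^ 'n ^ 'm" and h :: "real ^ 'm \<Rightarrow> real"
  assumes convex: "convex_on UNIV h"
    and x0: "x0 \<in> sol_map A h (b0, l0)" and l0: "0 < l0"
    and C2: "twice_cont_diff_around h (A *v x0 - b0)"
    and ker: "mat_ker (hessian h (A *v x0 - b0)) \<inter> rge_cols A (equi_index A h (b0, l0) x0) = {0}"
  obtains \<epsilon> \<kappa> where "\<epsilon> > 0"
    "\<And>z z' x x'. \<lbrakk>dist z (b0, l0) < \<epsilon>; dist z' (b0, l0) < \<epsilon>;
        x \<in> sol_map A h z; x' \<in> sol_map A h z';
        dist (A *v x) (A *v x0) < \<epsilon>; dist (A *v x') (A *v x0) < \<epsilon>\<rbrakk> \<Longrightarrow>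
        dist (A *v x) (A *v x') \<le> \<kappa> * dist z z'"
proof -
  define r0 where "r0 = A *v x0 - b0"
  define J where "J = equi_index A h (b0, l0) x0"
  define G where "G = grad h"
  define Q where "Q = hessian h r0"
  obtain V where V: "open V" "r0 \<in> V" and h_diff: "\<And>y. y \<in> V \<Longrightarrow> h differentiable (at y)"
    and G_diff: "\<And>y. y \<in> V \<Longrightarrow> G differentiable (at y)" and H_cont: "continuous_on V (hessian h)"
    using C2 unfolding twice_cont_diff_around_def r0_def G_def by blast
  have grad: "GDERIV h y :> G y" if "y \<in> V" for y
    unfolding G_def using h_diff[OF that] by (rule GDERIV_grad)
  have G_deriv: "(G has_derivative (*v) Q) (at r0)"
    using G_diff[OF V(2)] unfolding jacobian_works Q_def hessian_def G_def .

  have ker': "v = 0" if "v \<in> rge_cols A J" "Q *v v = 0" for v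
    using ker that unfolding J_def Q_def r0_def mat_ker_def by blast
  obtain c where c: "c > 0" "\<And>v. v \<in> rge_cols A J \<Longrightarrow> c * (norm v)\<^sup>2 \<le> v \<bullet> (Q *v v)"
  proof (rule positive_definite_on_subspace[of "(*v) Q" "rge_cols A J"])
    show "(v - u) \<bullet> (Q *v u) \<le> v \<bullet> (Q *v v)" for u v
      using gradient_derivative_cyclically_monotone[OF convex V h_diff] G_deriv unfolding G_def by blast
  qed (use ker' subspace_rge_cols in auto)

  have contJ: "continuous_on V (\<lambda>y. jacobian G (at y))" using H_cont unfolding hessian_def G_def .
  obtain \<delta> where \<delta>: "\<delta> > 0" "ball r0 \<delta> \<subseteq> V"
    and strict: "\<And>p q. p \<in> ball r0 \<delta> \<Longrightarrow> q \<in> ball r0 \<delta> \<Longrightarrow>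
       norm (G p - G q - Q *v (p - q)) \<le> c / 2 * norm (p - q)"
    using strictly_differentiable_if_continuous_jacobian[OF V G_diff contJ, of "c / 2"] c(1)
    unfolding Q_def hessian_def G_def by (metis half_gt_zero)
  define K where "K = onorm ((*v) Q) + c / 2"
  have G_lip: "norm (G p - G q) \<le> K * norm (p - q)" if "p \<in> ball r0 \<delta>" "q \<in> ball r0 \<delta>" for p q
  proof -
    have "norm (G p - G q) \<le> norm (G p - G q - Q *v (p - q)) + norm (Q *v (p - q))"
      using norm_triangle_ineq[of "G p - G q - Q *v (p - q)" "Q *v (p - q)"] by simp
    also have "\<dots> \<le> c / 2 * norm (p - q) + onorm ((*v) Q) * norm (p - q)"
      using strict[OF that] by (intro add_mono onorm) auto
    finally show ?thesis unfolding K_def by (simp add: algebra_simps)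
  qed
  have K: "0 \<le> K" unfolding K_def using c(1) onorm_pos_le[of "(*v) Q"] by auto
  have G_mono: "c / 2 * (norm (p - q))\<^sup>2 \<le> (p - q) \<bullet> (G p - G q)"
    if "p \<in> ball r0 \<delta>" "q \<in> ball r0 \<delta>" "p - q \<in> rge_cols A J" for p q
  proof -
    have "- ((p - q) \<bullet> (G p - G q - Q *v (p - q))) \<le> norm (p - q) * norm (G p - G q - Q *v (p - q))"
      using Cauchy_Schwarz_ineq2[of "p - q" "G p - G q - Q *v (p - q)"] by linarith
    also have "\<dots> \<le> norm (p - q) * (c / 2 * norm (p - q))"
      using strict[OF that(1,2)] by (intro mult_left_mono) auto
    finally show ?thesis
      using c(2)[OF that(3)] by (simp add: inner_diff_right power2_eq_square algebra_simps)
  qed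

  \<comment> \<open>Optimality at \<open>x0\<close> gives \<open>\<le>\<close>, and \<open>J\<close> collects the indices with equality.\<close>
  have inactive: "\<bar>column i A \<bullet> G r0\<bar> < l0" if "i \<notin> J" for i
    using column_gradient_le[OF x0 _ grad[OF V(2), unfolded r0_def], of i] l0 that
    unfolding J_def equi_index_def r0_def G_def by fastforce
  have "isCont G r0" using G_deriv by (rule has_derivative_continuous)
  then have G_tendsto: "((\<lambda>w. G (fst w)) \<longlongrightarrow> G r0) (nhds (r0, l0))"
    by (intro isCont_tendsto_compose[where g = G] tendsto_eq_intros) (auto intro!: tendsto_eq_intros filterlim_ident)
  have snd_tendsto: "(snd \<longlongrightarrow> l0) (nhds (r0, l0))"
    using tendsto_snd[OF filterlim_ident[of "nhds (r0, l0)"]] by simp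
  have "eventually (\<lambda>w. \<forall>i\<in>- J. \<bar>column i A \<bullet> G (fst w)\<bar> < snd w) (nhds (r0, l0))"
  proof (rule eventually_ball_finite, simp, intro ballI)
    fix i assume "i \<in> - J"
    then have "\<bar>column i A \<bullet> G r0\<bar> - l0 < 0" using inactive by simp
    moreover have "((\<lambda>w. \<bar>column i A \<bullet> G (fst w)\<bar> - snd w) \<longlongrightarrow> \<bar>column i A \<bullet> G r0\<bar> - l0) (nhds (r0, l0))"
      by (intro tendsto_intros G_tendsto snd_tendsto)
    ultimately have "eventually (\<lambda>w. \<bar>column i A \<bullet> G (fst w)\<bar> - snd w < 0) (nhds (r0, l0))"
      by (rule order_tendstoD(2)[rotated])
    then show "eventually (\<lambda>w. \<bar>column i A \<bullet> G (fst w)\<bar> < snd w) (nhds (r0, l0))"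
      by eventually_elim simp
  qed
  moreover have "eventually (\<lambda>w. l0 / 2 < snd w) (nhds (r0, l0))"
    using snd_tendsto l0 by (intro order_tendstoD(1)[of _ l0]) auto
  moreover have "eventually (\<lambda>w. snd w < 2 * l0) (nhds (r0, l0))"
    using snd_tendsto l0 by (intro order_tendstoD(2)[of _ l0]) auto
  moreover have "eventually (\<lambda>w. norm (G (fst w)) < norm (G r0) + 1) (nhds (r0, l0))"
    using tendsto_norm[OF G_tendsto] by (rule order_tendstoD(2)) simp
  moreover have "eventually (\<lambda>w. fst w \<in> ball r0 \<delta>) (nhds (r0, l0))"
  proof (rule topological_tendstoD[where l = r0])
    show "(fst \<longlongrightarrow> r0) (nhds (r0, l0))"
      using tendsto_fst[OF filterlim_ident[of "nhds (r0, l0)"]] by simp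
  qed (use \<delta> in auto)
  ultimately have "eventually (\<lambda>w. (\<forall>i\<in>- J. \<bar>column i A \<bullet> G (fst w)\<bar> < snd w) \<and> l0 / 2 < snd w
      \<and> snd w < 2 * l0 \<and> norm (G (fst w)) < norm (G r0) + 1 \<and> fst w \<in> ball r0 \<delta>) (nhds (r0, l0))"
    by eventually_elim simp
  then obtain d where d: "d > 0" and near: "\<And>w. dist w (r0, l0) < d \<Longrightarrow>
      (\<forall>i\<in>- J. \<bar>column i A \<bullet> G (fst w)\<bar> < snd w) \<and> l0 / 2 < snd w
      \<and> snd w < 2 * l0 \<and> norm (G (fst w)) < norm (G r0) + 1 \<and> fst w \<in> ball r0 \<delta>"
    unfolding eventually_nhds_metric by blast

  define \<epsilon> where "\<epsilon> = d / 3"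
  define N where "N = 2 * l0 * K + (norm (G r0) + 1)"
  define \<kappa> where "\<kappa> = 4 * N / (l0 * c)"
  have "\<epsilon> > 0" using d by (simp add: \<epsilon>_def)
  moreover have "dist (A *v x) (A *v x') \<le> \<kappa> * dist z z'"
    if z: "dist z (b0, l0) < \<epsilon>" "dist z' (b0, l0) < \<epsilon>"
      and x: "x \<in> sol_map A h z" "x' \<in> sol_map A h z'"
      and Ax: "dist (A *v x) (A *v x0) < \<epsilon>" "dist (A *v x') (A *v x0) < \<epsilon>" for z z' x x'
  proof -
    obtain b l b' l' where zz': "z = (b, l)" "z' = (b', l')" by (meson surj_pair)
    have close: "dist (A *v u - \<beta>, \<mu>) (r0, l0) < d"
      if "dist (A *v u) (A *v x0) < \<epsilon>" "dist (\<beta>, \<mu>) (b0, l0) < \<epsilon>" for u \<beta> \<mu>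
    proof -
      have "dist \<beta> b0 < \<epsilon>" "dist \<mu> l0 < \<epsilon>"
        using that(2) dist_fst_le[of "(\<beta>, \<mu>)" "(b0, l0)"] dist_snd_le[of "(\<beta>, \<mu>)" "(b0, l0)"] by auto
      moreover have "dist (A *v u - \<beta>) r0 \<le> dist (A *v u) (A *v x0) + dist \<beta> b0"
        unfolding r0_def dist_norm using norm_triangle_ineq4[of "A *v u - A *v x0" "\<beta> - b0"]
        by (simp add: algebra_simps)
      moreover have "dist (A *v u - \<beta>, \<mu>) (r0, l0) \<le> dist (A *v u - \<beta>) r0 + dist \<mu> l0"
        unfolding dist_Pair_Pair by (intro sqrt_sum_squares_le_sum) auto
      ultimately show ?thesis using that(1) unfolding \<epsilon>_def by linarith
    qed
    \<comment> \<open>The auxiliary residual \<open>p\<close> differs from \<open>r'\<close> exactly by \<open>w\<close>, and from \<open>r\<close> by the data change.\<close>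
    define r r' p where "r = A *v x - b" and "r' = A *v x' - b'" and "p = A *v x - b'"
    have near_r: "(\<forall>i\<in>- J. \<bar>column i A \<bullet> G r\<bar> < l) \<and> l0 / 2 < l \<and> l < 2 * l0
        \<and> norm (G r) < norm (G r0) + 1 \<and> r \<in> ball r0 \<delta>"
      using near[OF close[OF Ax(1) z(1)[unfolded zz']]] by (simp add: r_def)
    have near_r': "(\<forall>i\<in>- J. \<bar>column i A \<bullet> G r'\<bar> < l') \<and> l0 / 2 < l' \<and> l' < 2 * l0
        \<and> norm (G r') < norm (G r0) + 1 \<and> r' \<in> ball r0 \<delta>"
      using near[OF close[OF Ax(2) z(2)[unfolded zz']]] by (simp add: r'_def)
    have p: "p \<in> ball r0 \<delta>"
      using near[OF close[OF Ax(1) z(2)[unfolded zz']]] by (simp add: p_def)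
    have l: "0 \<le> l" "0 \<le> l'" using near_r near_r' l0 by auto
    have sol: "x \<in> sol_map A h (b, l)" "x' \<in> sol_map A h (b', l')" using x zz' by auto
    have gr: "GDERIV h (A *v x - b) :> G r" "GDERIV h (A *v x' - b') :> G r'"
      using grad near_r near_r' \<delta>(2) unfolding r_def r'_def by blast+
    define w where "w = A *v x - A *v x'"
    have "A *v (x - x') \<in> rge_cols A J"
    proof (rule matrix_vector_mult_in_rge_cols)
      fix i assume "i \<notin> J"
      then show "(x - x') $ i = 0"
        using sol_map_coordinate_eq_0[OF sol(1) l(1) gr(1), of i]
          sol_map_coordinate_eq_0[OF sol(2) l(2) gr(2), of i] near_r near_r' by simp
    qed
    then have w: "w \<in> rge_cols A J" unfolding w_def by (simp add: matrix_vector_mult_diff_distrib)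
    have pr: "p - r' = w" "p - r = b - b'" by (simp_all add: p_def r'_def r_def w_def)

    \<comment> \<open>Each solution is tested against the other; weighting by \<open>l'\<close> and \<open>l\<close> cancels the penalties.\<close>
    have monotone: "w \<bullet> (l' *\<^sub>R G r - l *\<^sub>R G r') \<le> 0"
    proof -
      have "l * l1_norm x \<le> l * l1_norm x' - w \<bullet> G r"
        using sol_map_optimality[OF sol(1) l(1) gr(1), of x']
        by (simp add: w_def matrix_vector_mult_diff_distrib inner_diff_left)
      from mult_left_mono[OF this l(2)]
      have 1: "l' * (w \<bullet> G r) \<le> l' * l * l1_norm x' - l' * l * l1_norm x" by (simp add: algebra_simps)
      have "l' * l1_norm x' \<le> l' * l1_norm x + w \<bullet> G r'"
        using sol_map_optimality[OF sol(2) l(2) gr(2), of x]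
        by (simp add: w_def matrix_vector_mult_diff_distrib inner_diff_left)
      from mult_left_mono[OF this l(1)]
      have "- (l * (w \<bullet> G r')) \<le> l' * l * l1_norm x - l' * l * l1_norm x'" by (simp add: algebra_simps)
      with 1 show ?thesis by (simp add: inner_diff_right)
    qed
    have "l0 / 2 * (c / 2 * (norm w)\<^sup>2) \<le> l' * (w \<bullet> (G p - G r'))"
      using G_mono[of p r'] p near_r' w l0 c(1) by (intro mult_mono) (auto simp: pr)
    also have "\<dots> = w \<bullet> (l' *\<^sub>R G r - l *\<^sub>R G r') + w \<bullet> (l' *\<^sub>R (G p - G r) + (l - l') *\<^sub>R G r')"
      by (simp add: algebra_simps inner_diff_right inner_add_right)
    also have "\<dots> \<le> w \<bullet> (l' *\<^sub>R (G p - G r) + (l - l') *\<^sub>R G r')" using monotone by simp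
    also have "\<dots> \<le> norm w * norm (l' *\<^sub>R (G p - G r) + (l - l') *\<^sub>R G r')" by (rule norm_cauchy_schwarz)
    also have "\<dots> \<le> norm w * (N * dist z z')"
    proof (rule mult_left_mono)
      have "norm (l' *\<^sub>R (G p - G r)) \<le> 2 * l0 * (K * dist b b')"
        using G_lip[of p r] p near_r near_r' l(2) l0 by (auto simp: pr dist_norm intro!: mult_mono)
      also have "\<dots> \<le> 2 * l0 * (K * dist z z')"
        using dist_fst_le[of z z'] l0 K zz' by (intro mult_left_mono) auto
      finally have 1: "norm (l' *\<^sub>R (G p - G r)) \<le> 2 * l0 * (K * dist z z')" .
      have "norm ((l - l') *\<^sub>R G r') \<le> dist l l' * (norm (G r0) + 1)"
        using near_r' by (auto simp: dist_norm intro!: mult_left_mono)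
      also have "\<dots> \<le> dist z z' * (norm (G r0) + 1)"
        using dist_snd_le[of z z'] zz' by (intro mult_right_mono) auto
      finally show "norm (l' *\<^sub>R (G p - G r) + (l - l') *\<^sub>R G r') \<le> N * dist z z'"
        using 1 norm_triangle_ineq[of "l' *\<^sub>R (G p - G r)" "(l - l') *\<^sub>R G r'"]
        unfolding N_def by (simp add: algebra_simps)
    qed simp
    finally have main: "norm w * (l0 * c / 4 * norm w) \<le> norm w * (N * dist z z')"
      by (simp add: power2_eq_square algebra_simps)
    have "l0 * c / 4 * norm w \<le> N * dist z z'"
    proof (cases "w = 0")
      case True
      have "0 \<le> N" unfolding N_def using l0 K by simp
      then show ?thesis using True by simp
    next
      case False
      then show ?thesis using main by simp
    qed
    then show ?thesis
      unfolding \<kappa>_def w_def dist_norm using l0 c(1) by (simp add: field_simps)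
  qed
  ultimately show thesis by (rule that)
qed

section \<open>Existence and localization of solutions\<close>

lemma sol_map_segment:
  fixes A :: "real ^ 'n ^ 'm"
  assumes h: "convex_on UNIV h" and "0 \<le> l"
    and x: "x \<in> sol_map A h (b, l)" and y: "y \<in> sol_map A h (b, l)" and t: "0 \<le> t" "t \<le> 1"
  shows "x + t *\<^sub>R (y - x) \<in> sol_map A h (b, l)"
  unfolding sol_map_iff
proof
  fix u
  have "A *v (x + t *\<^sub>R (y - x)) - b = (1 - t) *\<^sub>R (A *v x - b) + t *\<^sub>R (A *v y - b)"
    by (simp add: matrix_vector_right_distrib matrix_vector_mult_scaleR
        matrix_vector_mult_diff_distrib algebra_simps)
  then have "h (A *v (x + t *\<^sub>R (y - x)) - b) \<le> (1 - t) * h (A *v x - b) + t * h (A *v y - b)"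
    using convex_onD[OF h t, of "A *v x - b" "A *v y - b"] by simp
  moreover have "l * l1_norm (x + t *\<^sub>R (y - x)) \<le> l * ((1 - t) * l1_norm x + t * l1_norm y)"
    using t \<open>0 \<le> l\<close> by (intro mult_left_mono l1_norm_convex_combination)
  moreover have "(1 - t) * (h (A *v x - b) + l * l1_norm x) \<le> (1 - t) * (h (A *v u - b) + l * l1_norm u)"
    using x t unfolding sol_map_iff by (intro mult_left_mono) auto
  moreover have "t * (h (A *v y - b) + l * l1_norm y) \<le> t * (h (A *v u - b) + l * l1_norm u)"
    using y t unfolding sol_map_iff by (intro mult_left_mono) auto
  ultimately show "h (A *v (x + t *\<^sub>R (y - x)) - b) + l * l1_norm (x + t *\<^sub>R (y - x))
      \<le> h (A *v u - b) + l * l1_norm u"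
    by (simp add: algebra_simps)
qed

text \<open>
  Outside a ball of radius \<open>h (- b) / l\<close> the penalty alone exceeds the objective value at \<open>0\<close>.
\<close>

lemma sol_map_nonempty:
  fixes A :: "real ^ 'n ^ 'm"
  assumes nonneg: "\<And>y. 0 \<le> h y" and cont: "continuous_on UNIV h" and l: "0 < l"
  shows "sol_map A h (b, l) \<noteq> {}"
proof -
  define f where "f x = h (A *v x - b) + l * l1_norm x" for x
  define R where "R = h (- b) / l"
  have R: "0 \<le> R" unfolding R_def using nonneg l by simp
  have "continuous_on (cball 0 R) f"
    unfolding f_def
    by (intro continuous_intros continuous_on_compose2[OF cont]) auto
  moreover have "cball (0 :: real ^ 'n) R \<noteq> {}" using R by simp
  ultimately obtain x where x: "x \<in> cball 0 R" "\<And>u. u \<in> cball 0 R \<Longrightarrow> f x \<le> f u"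
    using continuous_attains_inf[OF compact_cball] by metis
  have "f x \<le> f u" for u
  proof (cases "u \<in> cball 0 R")
    case False
    then have "h (- b) < l * norm u" using l by (simp add: R_def field_simps)
    also have "\<dots> \<le> f u" unfolding f_def using l nonneg by (intro add_increasing mult_left_mono norm_le_l1_norm) auto
    finally have "f 0 < f u" by (simp add: f_def)
    moreover have "f x \<le> f 0" using x(2) R by simp
    ultimately show ?thesis by simp
  qed (rule x)
  then have "x \<in> sol_map A h (b, l)" unfolding sol_map_iff f_def by blast
  then show ?thesis by blast
qed

lemma sol_map_norm_le:
  assumes nonneg: "\<And>y. 0 \<le> h y" and x: "x \<in> sol_map A h (b, l)" and l: "0 < l"
  shows "l * norm x \<le> h (- b)"
proof -
  have "h (A *v x - b) + l * l1_norm x \<le> h (- b)"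
    using x unfolding sol_map_iff by (metis add.right_neutral diff_0 l1_norm_zero matrix_vector_mult_0_right mult_zero_right)
  moreover have "l * norm x \<le> l * l1_norm x" using l norm_le_l1_norm by simp
  ultimately show ?thesis using nonneg[of "A *v x - b"] by linarith
qed

text \<open>
  Compactness: over a small ball of parameters, the pairs of a parameter and a solution whose fit is
  at least \<open>\<epsilon>\<close> away from \<open>y0\<close> form a compact set.  No such pair has parameter \<open>(b0, l0)\<close>, so the
  parameters of all such pairs keep a positive distance from it.
\<close>

lemma fit_near_unique_fit:
  fixes A :: "real ^ 'n ^ 'm" and h :: "real ^ 'm \<Rightarrow> real"
  assumes nonneg: "\<And>y. 0 \<le> h y" and cont: "continuous_on UNIV h" and l0: "0 < l0"
    and unique: "\<And>x. x \<in> sol_map A h (b0, l0) \<Longrightarrow> A *v x = y0" and "\<epsilon> > 0"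
  obtains \<delta> where "\<delta> > 0"
    "\<And>z x. dist z (b0, l0) < \<delta> \<Longrightarrow> x \<in> sol_map A h z \<Longrightarrow> dist (A *v x) y0 < \<epsilon>"
proof -
  define B where "B = cball (b0, l0) (l0 / 2)"
  define S where "S = {(z, x). z \<in> B \<and> x \<in> sol_map A h z \<and> \<epsilon> \<le> dist (A *v x) y0}"
  have B_pos: "l0 / 2 \<le> snd z" if "z \<in> B" for z
    using that dist_snd_le[of "(b0, l0)" z] unfolding B_def by (auto simp: dist_real_def)
  have "bounded ((\<lambda>z. h (- fst z)) ` B)"
    unfolding B_def
    by (intro compact_imp_bounded compact_continuous_image continuous_intros compact_cball
        continuous_on_compose2[OF cont]) auto
  then obtain M where M: "\<And>z. z \<in> B \<Longrightarrow> h (- fst z) \<le> M"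
    unfolding bounded_iff by (metis abs_le_D1 imageI real_norm_def)
  have "S \<subseteq> B \<times> cball 0 (2 * M / l0)"
  proof (clarsimp simp: S_def)
    fix b l x assume z: "(b, l) \<in> B" and x: "x \<in> sol_map A h (b, l)"
    have "l0 / 2 * norm x \<le> l * norm x" using B_pos[OF z] by (intro mult_right_mono) auto
    also have "\<dots> \<le> h (- b)" using B_pos[OF z] l0 by (intro sol_map_norm_le[OF nonneg x]) auto
    also have "\<dots> \<le> M" using M[OF z] by simp
    finally show "norm x \<le> 2 * M / l0" using l0 by (simp add: field_simps)
  qed
  then have "bounded S" by (rule bounded_subset[rotated]) (auto simp: B_def intro: bounded_Times)
  moreover have "closed S"
  proof -
    have "S = (B \<times> UNIV) \<inter> {w. \<epsilon> \<le> dist (A *v snd w) y0} \<inter>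
      (\<Inter>u. {w. h (A *v snd w - fst (fst w)) + snd (fst w) * l1_norm (snd w)
               \<le> h (A *v u - fst (fst w)) + snd (fst w) * l1_norm u})"
      unfolding S_def by (auto simp: sol_map_iff)
    also have "closed \<dots>"
      unfolding B_def
      by (intro closed_Int closed_INT ballI closed_Times closed_cball closed_UNIV closed_Collect_le
          continuous_intros continuous_on_compose2[OF cont] continuous_on_compose2[OF matrix_vector_mult_linear_continuous_on]) auto
    finally show ?thesis .
  qed
  ultimately have "compact S" by (simp add: compact_eq_bounded_closed)
  have "\<exists>\<delta>>0. \<forall>w\<in>S. \<delta> \<le> dist (fst w) (b0, l0)"
  proof (cases "S = {}")
    case True
    then show ?thesis by (intro exI[of _ 1]) auto
  next
    case False
    have "continuous_on S (\<lambda>w. dist (fst w) (b0, l0))" by (intro continuous_intros)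
    from continuous_attains_inf[OF \<open>compact S\<close> False this]
    obtain w0 where w0: "w0 \<in> S" "\<forall>w\<in>S. dist (fst w0) (b0, l0) \<le> dist (fst w) (b0, l0)" by blast
    have "fst w0 \<noteq> (b0, l0)" using w0(1) unique \<open>\<epsilon> > 0\<close> unfolding S_def by force
    then show ?thesis using w0(2) by (intro exI[of _ "dist (fst w0) (b0, l0)"]) auto
  qed
  then obtain \<delta> where \<delta>: "\<delta> > 0" "\<And>w. w \<in> S \<Longrightarrow> \<delta> \<le> dist (fst w) (b0, l0)" by blast
  show thesis
  proof (rule that[of "min \<delta> (l0 / 2)"])
    show "min \<delta> (l0 / 2) > 0" using \<delta> l0 by simp
    fix z x assume z: "dist z (b0, l0) < min \<delta> (l0 / 2)" and x: "x \<in> sol_map A h z"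
    have "z \<in> B" using z unfolding B_def by (simp add: dist_commute)
    moreover have "(z, x) \<notin> S" using \<delta>(2)[of "(z, x)"] z by auto
    ultimately show "dist (A *v x) y0 < \<epsilon>" using x unfolding S_def by auto
  qed
qed

section \<open>Local and global Lipschitz continuity of the solution map\<close>

text \<open>
  The local estimate applies once solutions for nearby parameters are known to have fits near
  \<open>A *v x0\<close>, and that follows by compactness from uniqueness of the fit at \<open>(b0, l0)\<close>.  Uniqueness is
  again a consequence of the local estimate: the solutions at \<open>(b0, l0)\<close> form a convex set, so a
  second fit would bring along further ones arbitrarily close to \<open>A *v x0\<close>.
\<close>

theorem sol_map_locally_lipschitz:
  fixes A :: "real ^ 'n ^ 'm" and h :: "real ^ 'm \<Rightarrow> real"
  assumes nonneg: "\<And>y. 0 \<le> h y" and cont: "continuous_on UNIV h" and convex: "convex_on UNIV h"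
    and x0: "x0 \<in> sol_map A h (b0, l0)" and l0: "0 < l0"
    and C2: "twice_cont_diff_around h (A *v x0 - b0)"
    and ker: "mat_ker (hessian h (A *v x0 - b0)) \<inter> rge_cols A (equi_index A h (b0, l0) x0) = {0}"
  shows "locally_hausdorff_lipschitz_at (sol_map A h) (b0, l0)"
proof -
  obtain \<epsilon> \<kappa> where \<epsilon>: "\<epsilon> > 0" and local_est: "\<And>z z' x x'. \<lbrakk>dist z (b0, l0) < \<epsilon>; dist z' (b0, l0) < \<epsilon>;
        x \<in> sol_map A h z; x' \<in> sol_map A h z';
        dist (A *v x) (A *v x0) < \<epsilon>; dist (A *v x') (A *v x0) < \<epsilon>\<rbrakk> \<Longrightarrow>
        dist (A *v x) (A *v x') \<le> \<kappa> * dist z z'"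
    by (rule local_fit_estimate[OF convex x0 l0 C2 ker], rule that)
  have unique: "A *v x = A *v x0" if x: "x \<in> sol_map A h (b0, l0)" for x
  proof -
    define v where "v = A *v x - A *v x0"
    \<comment> \<open>A step length short enough for the local estimate to apply.\<close>
    define t where "t = min 1 (\<epsilon> / (norm v + 1))"
    have t: "0 < t" "t \<le> 1" unfolding t_def using \<epsilon> by (auto intro!: divide_pos_pos add_nonneg_pos)
    define u where "u = x0 + t *\<^sub>R (x - x0)"
    have u: "u \<in> sol_map A h (b0, l0)"
      unfolding u_def using t l0 by (intro sol_map_segment convex x0 x) auto
    have Au: "A *v u - A *v x0 = t *\<^sub>R v"
      by (simp add: u_def v_def matrix_vector_right_distrib matrix_vector_mult_scaleR
          matrix_vector_mult_diff_distrib)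
    have "t * norm v \<le> \<epsilon> / (norm v + 1) * norm v"
      unfolding t_def by (intro mult_right_mono) auto
    also have "\<dots> < \<epsilon>"
    proof -
      have "0 < norm v + 1" using norm_ge_zero[of v] by linarith
      moreover have "\<epsilon> * norm v < \<epsilon> * (norm v + 1)" using \<epsilon> by simp
      ultimately show ?thesis by (simp only: times_divide_eq_left pos_divide_less_eq)
    qed
    finally have "dist (A *v u) (A *v x0) < \<epsilon>" using t Au by (simp add: dist_norm)
    from local_est[OF _ _ u x0 this] have "A *v u = A *v x0" using \<epsilon> by simp
    then have "v = 0" using Au t by simp
    then show ?thesis by (simp add: v_def)
  qed
  obtain \<delta> where \<delta>: "\<delta> > 0"
    and near: "\<And>z x. dist z (b0, l0) < \<delta> \<Longrightarrow> x \<in> sol_map A h z \<Longrightarrow> dist (A *v x) (A *v x0) < \<epsilon>"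
    by (rule fit_near_unique_fit[OF nonneg cont l0 unique \<epsilon>]) (assumption | rule that)+
  define \<rho> where "\<rho> = min (min \<delta> \<epsilon>) l0"
  have \<rho>: "\<rho> > 0" using \<delta> \<epsilon> l0 by (simp add: \<rho>_def)
  have "hausdorff_lipschitz_on (ball (b0, l0) \<rho>) (sol_map A h)"
  proof (rule sol_map_lipschitz)
    show pos: "0 < snd z" if "z \<in> ball (b0, l0) \<rho>" for z
      using that dist_snd_le[of "(b0, l0)" z] unfolding \<rho>_def by (auto simp: dist_real_def)
    show "sol_map A h z \<noteq> {}" if "z \<in> ball (b0, l0) \<rho>" for z
      using sol_map_nonempty[OF nonneg cont pos[OF that], of A "fst z"] by simp
    show "dist (A *v x) (A *v x') \<le> \<kappa> * dist z z'"
      if "z \<in> ball (b0, l0) \<rho>" "z' \<in> ball (b0, l0) \<rho>" "x \<in> sol_map A h z" "x' \<in> sol_map A h z'"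
      for z z' x x'
    proof -
      have d: "dist z (b0, l0) < \<delta>" "dist z' (b0, l0) < \<delta>" "dist z (b0, l0) < \<epsilon>" "dist z' (b0, l0) < \<epsilon>"
        using that(1,2) by (auto simp: \<rho>_def dist_commute)
      show ?thesis
        by (rule local_est[OF d(3,4) that(3,4) near[OF d(1) that(3)] near[OF d(2) that(4)]])
    qed
  qed
  then show ?thesis unfolding locally_hausdorff_lipschitz_at_def using \<rho> by blast
qed

theorem theorem3p2:
  fixes A :: "real ^ 'n ^ 'm" and h :: "real ^ 'm \<Rightarrow> real"
  assumes h_nonneg: "\<forall>z. 0 \<le> h z"
    and h_cont: "continuous_on UNIV h"
    and h_convex: "convex_on UNIV h"
  shows
    "(\<forall>U :: ((real ^ 'm) \<times> real) set.
        convex U \<and> open U \<and> U \<subseteq> UNIV \<times> {0<..} \<and>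
        single_valued_map_on U (fit_map A h) \<and>
        hausdorff_lipschitz_on U (fit_map A h) \<and>
        (\<forall>b l x. (b, l) \<in> U \<and> A *v x \<in> fit_map A h (b, l) \<longrightarrow> cont_diff_at h (A *v x - b))
        \<longrightarrow> hausdorff_lipschitz_on U (sol_map A h))
     \<and>
     (\<forall>(b :: real ^ 'm) (l :: real).
        0 < l \<and>
        (\<exists>x \<in> sol_map A h (b, l).
           twice_cont_diff_around h (A *v x - b) \<and>
           mat_ker (hessian h (A *v x - b)) \<inter> rge_cols A (equi_index A h (b, l) x) = {0})
        \<longrightarrow> locally_hausdorff_lipschitz_at (sol_map A h) (b, l))"
proof (intro conjI allI impI; elim conjE)
  fix U :: "((real ^ 'm) \<times> real) set"
  assume "U \<subseteq> UNIV \<times> {0<..}" "single_valued_map_on U (fit_map A h)"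
    "hausdorff_lipschitz_on U (fit_map A h)"
  then show "hausdorff_lipschitz_on U (sol_map A h)" by (rule sol_map_lipschitz_if_fit_map_lipschitz)
next
  fix b :: "real ^ 'm" and l :: real
  assume "0 < l" and "\<exists>x \<in> sol_map A h (b, l).
           twice_cont_diff_around h (A *v x - b) \<and>
           mat_ker (hessian h (A *v x - b)) \<inter> rge_cols A (equi_index A h (b, l) x) = {0}"
  then show "locally_hausdorff_lipschitz_at (sol_map A h) (b, l)"
    using h_nonneg h_cont h_convex by (blast intro: sol_map_locally_lipschitz)
qed

end
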